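(* Let $G=G_1+\dots+G_k$ be a factorisation of a Left dead end $G$ into atoms $G_1,\dots,G_k$ such that, for every $1\leq i\leq k$, the game $G_i+G_{i+1}+\dots+G_k$ has a good option of the form $G_i'+G_{i+1}+\dots+G_k$ where $G_i'$ is an option of $G_i$ that is prime-factorisable. Then $G$ is uniquely factorisable.
   Context: All games are short partizan combinatorial game forms; $G+H$ is the disjunctive sum. Play is misère (a player unable to move wins). Misère outcome classes are ordered $\mathscr L>\mathscr P>\mathscr R$ and $\mathscr L>\mathscr N>\mathscr R$; $G\geq H$ means that for every game $X$ the misère outcome of $G+X$ is $\geq$ that of $H+X$, $G=H$ means $G\ge H$ and $H\ge G$, and $G>H$ means $G\ge H$ and $G\ne H$. A Left dead end is a game no subposition of which (including itself) has a Left option; its options are its Right options; the options of a sum $X+Y$ of Left dead ends are the games $X'+Y$ and $X+Y'$. An option $G'$ of $G$ is good if there is no option $G''$ of $G$ with $G'>G''$. The Left dead ends up to equality form a commutative monoid $\mathcal L$ under $+$ with identity $0=\{\cdot\mid\cdot\}$. An atom is a Left dead end $A\neq0$ such that $A=X+Y$ with Left dead ends $X,Y$ implies $X=0$ or $Y=0$. A factorisation of $G$ is an expression $G=A_1+\dots+A_k$ ($k\ge0$) with atoms $A_i$, considered up to reordering and replacing atoms by equal ones; $G$ is uniquely factorisable if it has exactly one factorisation. For Left dead ends, $P\mid X$ means $X=P+Y$ for some Left dead end $Y$; a prime is a Left dead end $P\neq0$ such that $P\mid X+Y$ implies $P\mid X$ or $P\mid Y$. A Left dead end is prime-factorisable if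 it has a factorisation consisting only of primes (the empty sum, i.e. $0$, included). *)

theory Defs
  imports Main "HOL-Library.FSet" "HOL-Library.Multiset"
begin

section \<open>Short partizan game forms\<close>

datatype game = Game (left_opts: "game fset") (right_opts: "game fset")

lemma size_left_option [termination_simp]: "H |\<in>| left_opts G \<Longrightarrow> size H < size G"
  and size_right_option [termination_simp]: "H |\<in>| right_opts G \<Longrightarrow> size H < size G"
proof -
  have le: "size H < (\<Sum>x\<in>fset A. Suc (size x))" if "H |\<in>| A" for A :: "game fset"
  proof -
    have "Suc (size H) \<le> (\<Sum>x\<in>fset A. Suc (size x))"
      using that by (intro member_le_sum) auto
    thus ?thesis by simp
  qed
  show "H |\<in>| left_opts G \<Longrightarrow> size H < size G"
    by (cases G) (auto dest!: le)
  show "H |\<in>| right_opts G \<Longrightarrow> size H < size G"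
    by (cases G) (auto dest!: le)
qed

lemma fimage_fundef_cong [fundef_cong]:
  "A = B \<Longrightarrow> (\<And>x. x |\<in>| B \<Longrightarrow> f x = g x) \<Longrightarrow> f |`| A = g |`| B"
  by (auto simp: fset_eq_iff fimage_iff)

text \<open>
  The disjunctive sum. Options form finite sets, so it is associative and commutative, with
  identity \<open>0\<close>, already as an operation on forms.
\<close>

instantiation game :: comm_monoid_add
begin

definition zero_game :: game where
  "0 = Game {||} {||}"

function plus_game :: "game \<Rightarrow> game \<Rightarrow> game" where
  "plus_game G H = Game
     ((\<lambda>G'. plus_game G' H) |`| left_opts G |\<union>| (\<lambda>H'. plus_game G H') |`| left_opts H)
     ((\<lambda>G'. plus_game G' H) |`| right_opts G |\<union>| (\<lambda>H'. plus_game G H') |`| right_opts H)"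
  by auto
termination
  by (relation "measure (\<lambda>(G, H). size G + size H)")
    (auto simp: size_left_option size_right_option)

declare plus_game.simps [simp del]

lemma left_opts_plus:
  "left_opts (G + H) = (\<lambda>G'. G' + H) |`| left_opts G |\<union>| (\<lambda>H'. G + H') |`| left_opts H"
  for G H :: game
  by (subst plus_game.simps) simp

lemma right_opts_plus:
  "right_opts (G + H) = (\<lambda>G'. G' + H) |`| right_opts G |\<union>| (\<lambda>H'. G + H') |`| right_opts H"
  for G H :: game
  by (subst plus_game.simps) simp

instance
proof
  show "a + b + c = a + (b + c)" for a b c :: game
  proof (induction "size a + size b + size c" arbitrary: a b c rule: less_induct)
    case less
    have "left_opts (a + b + c) = left_opts (a + (b + c))"
      unfolding left_opts_plus fimage_funion fset.map_comp o_def funion_assoc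
      by (intro arg_cong2[of _ _ _ _ "(|\<union>|)"] fset.map_cong refl less)
        (auto simp: size_left_option)
    moreover have "right_opts (a + b + c) = right_opts (a + (b + c))"
      unfolding right_opts_plus fimage_funion fset.map_comp o_def funion_assoc
      by (intro arg_cong2[of _ _ _ _ "(|\<union>|)"] fset.map_cong refl less)
        (auto simp: size_right_option)
    ultimately show ?case by (simp add: game.expand)
  qed
  show "a + b = b + a" for a b :: game
  proof (induction "size a + size b" arbitrary: a b rule: less_induct)
    case less
    have "left_opts (a + b) = left_opts (b + a)"
      unfolding left_opts_plus funion_commute[of "(\<lambda>G'. G' + a) |`| left_opts b"]
      by (intro arg_cong2[of _ _ _ _ "(|\<union>|)"] fset.map_cong refl less)
        (auto simp: size_left_option)
    moreover have "right_opts (a + b) = right_opts (b + a)"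
      unfolding right_opts_plus funion_commute[of "(\<lambda>G'. G' + a) |`| right_opts b"]
      by (intro arg_cong2[of _ _ _ _ "(|\<union>|)"] fset.map_cong refl less)
        (auto simp: size_right_option)
    ultimately show ?case by (simp add: game.expand)
  qed
  show "0 + a = a" for a :: game
  proof (induction "size a" arbitrary: a rule: less_induct)
    case less
    have "left_opts (0 + a) = left_opts a"
      unfolding left_opts_plus using less
      by (auto simp: zero_game_def size_left_option fset_eq_iff fimage_iff)
    moreover have "right_opts (0 + a) = right_opts a"
      unfolding right_opts_plus using less
      by (auto simp: zero_game_def size_right_option fset_eq_iff fimage_iff)
    ultimately show ?case by (simp add: game.expand)
  qed
qed

end


section \<open>Misere outcomes and the order on games\<close>

text \<open>The player to move wins if they have no move, or if some move leaves a position that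
  the opponent does not win moving first.\<close>

function left_wins_first :: "game \<Rightarrow> bool" and right_wins_first :: "game \<Rightarrow> bool" where
  "left_wins_first G \<longleftrightarrow>
     left_opts G = {||} \<or> (\<exists>G' |\<in>| left_opts G. \<not> right_wins_first G')"
| "right_wins_first G \<longleftrightarrow>
     right_opts G = {||} \<or> (\<exists>G' |\<in>| right_opts G. \<not> left_wins_first G')"
  by pat_completeness auto
termination
  by (relation "measure (case_sum size size)") (auto simp: size_left_option size_right_option)

declare left_wins_first.simps [simp del] right_wins_first.simps [simp del]

datatype outcome = Out_L | Out_P | Out_N | Out_R

instantiation outcome :: order
begin

definition less_eq_outcome :: "outcome \<Rightarrow> outcome \<Rightarrow> bool" where
  "o1 \<le> o2 \<longleftrightarrow> o1 = o2 \<or> o1 = Out_R \<or> o2 = Out_L"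

definition less_outcome :: "outcome \<Rightarrow> outcome \<Rightarrow> bool" where
  "o1 < o2 \<longleftrightarrow> o1 \<le> o2 \<and> o1 \<noteq> (o2 :: outcome)"

instance
  by standard (auto simp: less_eq_outcome_def less_outcome_def)

end

definition outcome :: "game \<Rightarrow> outcome" where
  "outcome G =
     (if left_wins_first G
      then (if right_wins_first G then Out_N else Out_L)
      else (if right_wins_first G then Out_R else Out_P))"

definition game_ge :: "game \<Rightarrow> game \<Rightarrow> bool" (infix "\<succeq>" 50) where
  "G \<succeq> H \<longleftrightarrow> (\<forall>X. outcome (G + X) \<ge> outcome (H + X))"

definition game_eq :: "game \<Rightarrow> game \<Rightarrow> bool" (infix "\<simeq>" 50) where
  "G \<simeq> H \<longleftrightarrow> G \<succeq> H \<and> H \<succeq> G"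

definition game_gt :: "game \<Rightarrow> game \<Rightarrow> bool" (infix "\<succ>" 50) where
  "G \<succ> H \<longleftrightarrow> G \<succeq> H \<and> \<not> G \<simeq> H"


section \<open>Left dead ends\<close>

inductive subposition :: "game \<Rightarrow> game \<Rightarrow> bool" where
  subposition_refl: "subposition G G"
| subposition_left: "subposition H G \<Longrightarrow> H' |\<in>| left_opts H \<Longrightarrow> subposition H' G"
| subposition_right: "subposition H G \<Longrightarrow> H' |\<in>| right_opts H \<Longrightarrow> subposition H' G"

definition left_dead_end :: "game \<Rightarrow> bool" where
  "left_dead_end G \<longleftrightarrow> (\<forall>H. subposition H G \<longrightarrow> left_opts H = {||})"

text \<open>Only meant for Left dead ends, whose options are their Right options.\<close>

definition good_option :: "game \<Rightarrow> game \<Rightarrow> bool" where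
  "good_option G' G \<longleftrightarrow>
     G' |\<in>| right_opts G \<and> \<not> (\<exists>G'' |\<in>| right_opts G. G' \<succ> G'')"


section \<open>Factorisations in the monoid of Left dead ends\<close>

text \<open>
  Elements of the monoid are represented by forms, and equality in the monoid is \<open>\<simeq>\<close>.
\<close>

definition atom :: "game \<Rightarrow> bool" where
  "atom A \<longleftrightarrow> left_dead_end A \<and> \<not> A \<simeq> 0 \<and>
     (\<forall>X Y. left_dead_end X \<longrightarrow> left_dead_end Y \<longrightarrow> A \<simeq> X + Y \<longrightarrow> X \<simeq> 0 \<or> Y \<simeq> 0)"

definition factorisation :: "game list \<Rightarrow> game \<Rightarrow> bool" where
  "factorisation As G \<longleftrightarrow> (\<forall>A \<in> set As. atom A) \<and> G \<simeq> sum_list As"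

definition uniquely_factorisable :: "game \<Rightarrow> bool" where
  "uniquely_factorisable G \<longleftrightarrow>
     (\<exists>As. factorisation As G \<and>
        (\<forall>Bs. factorisation Bs G \<longrightarrow> rel_mset (\<simeq>) (mset As) (mset Bs)))"

definition divides :: "game \<Rightarrow> game \<Rightarrow> bool" where
  "divides P X \<longleftrightarrow> (\<exists>Y. left_dead_end Y \<and> X \<simeq> P + Y)"

definition prime_end :: "game \<Rightarrow> bool" where
  "prime_end P \<longleftrightarrow> left_dead_end P \<and> \<not> P \<simeq> 0 \<and>
     (\<forall>X Y. left_dead_end X \<longrightarrow> left_dead_end Y \<longrightarrow> divides P (X + Y) \<longrightarrow>
        divides P X \<or> divides P Y)"

definition prime_factorisable :: "game \<Rightarrow> bool" where
  "prime_factorisable G \<longleftrightarrow>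
     left_dead_end G \<and> (\<exists>Ps. factorisation Ps G \<and> (\<forall>P \<in> set Ps. prime_end P))"

end

(*
  A comparison X \<succeq> Y of Left dead ends is decided recursively by their options (game_ge_iff).
  This makes the monoid of Left dead ends cancellative. Every play of the larger of two comparable
  ends has a counterpart of the same length in the smaller one, and so the set of lengths of plays
  takes the place of an additive rank.

  Now let G = G1 + S = B1 + T with atoms G1, B1. A good option G1' + S of G equals an option
  of the other factorisation, say B1' + T. Removing the prime factors of G1' one by one
  from G1' + S = B1' + T, and common prime factors from S and T, leaves S = D + T, whence
  G1 + D = B1 and G1 = B1. The tail S is then treated by induction.
*)
theory Submission
  imports Defs
begin

section \<open>The order on Left dead ends\<close>

text \<open>Trades the condition on all subpositions for a recursive one, which suits induction on
  size. With no Left options, every proper subposition lies below some Right option.\<close>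

lemma left_dead_end_iff:
  "left_dead_end G \<longleftrightarrow> left_opts G = {||} \<and> (\<forall>G' |\<in>| right_opts G. left_dead_end G')"
proof
  assume G: "left_dead_end G"
  have "subposition K H \<Longrightarrow> subposition H G \<Longrightarrow> subposition K G" for K H
    by (induction rule: subposition.induct) (auto intro: subposition.intros)
  with G show "left_opts G = {||} \<and> (\<forall>G' |\<in>| right_opts G. left_dead_end G')"
    unfolding left_dead_end_def by (meson subposition.intros)
next
  assume G: "left_opts G = {||} \<and> (\<forall>G' |\<in>| right_opts G. left_dead_end G')"
  have "H = G \<or> (\<exists>G' |\<in>| right_opts G. subposition H G')" if "subposition H G" for H
    using that G by (induction H G rule: subposition.induct) (blast intro: subposition.intros)+
  with G show "left_dead_end G"
    unfolding left_dead_end_def by blast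
qed

lemma left_opts_left_dead_end: "left_dead_end G \<Longrightarrow> left_opts G = {||}"
  and left_dead_end_right_option:
    "left_dead_end G \<Longrightarrow> G' |\<in>| right_opts G \<Longrightarrow> left_dead_end G'"
  by (simp_all add: left_dead_end_iff[of G])

lemma left_opts_zero [simp]: "left_opts 0 = {||}"
  and right_opts_zero [simp]: "right_opts 0 = {||}"
  by (simp_all add: zero_game_def)

lemma left_dead_end_zero [simp]: "left_dead_end 0"
  by (subst left_dead_end_iff) simp

lemma right_opts_eq_empty_iff: "left_dead_end G \<Longrightarrow> right_opts G = {||} \<longleftrightarrow> G = 0"
  by (auto simp: left_opts_left_dead_end intro: game.expand)

lemma right_opts_plus_iff:
  "K |\<in>| right_opts (G + H) \<longleftrightarrow>
     (\<exists>G'. G' |\<in>| right_opts G \<and> K = G' + H) \<or> (\<exists>H'. H' |\<in>| right_opts H \<and> K = G + H')"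
  for G H :: game
  by (auto simp: right_opts_plus)

lemma right_opts_plusI1: "G' |\<in>| right_opts G \<Longrightarrow> G' + H |\<in>| right_opts (G + H)"
  and right_opts_plusI2: "H' |\<in>| right_opts H \<Longrightarrow> G + H' |\<in>| right_opts (G + H)"
  for G H :: game
  by (auto simp: right_opts_plus_iff)

lemma left_opts_plus_left_dead_end:
  "left_dead_end G \<Longrightarrow> left_opts (G + X) = (\<lambda>X'. G + X') |`| left_opts X"
  by (simp add: left_opts_plus left_opts_left_dead_end)

lemma left_dead_end_plus:
  "left_dead_end G \<Longrightarrow> left_dead_end H \<Longrightarrow> left_dead_end (G + H)"
proof (induction "size G + size H" arbitrary: G H rule: less_induct)
  case less
  have "left_dead_end K" if "K |\<in>| right_opts (G + H)" for K
    using that less unfolding right_opts_plus_iff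
    by (auto dest: left_dead_end_right_option intro!: less.hyps simp: size_right_option)
  then show ?case
    using less.prems left_dead_end_iff[of "G + H"]
    by (simp add: left_opts_plus left_opts_left_dead_end)
qed

lemma left_dead_end_sum_list: "(\<And>A. A \<in> set As \<Longrightarrow> left_dead_end A) \<Longrightarrow> left_dead_end (sum_list As)"
  by (induction As) (auto intro: left_dead_end_plus)

lemma left_wins_first_left_dead_end: "left_dead_end G \<Longrightarrow> left_wins_first G"
  by (simp add: left_wins_first.simps left_opts_left_dead_end)

lemma game_ge_iff_wins:
  "G \<succeq> H \<longleftrightarrow> (\<forall>X. (left_wins_first (H + X) \<longrightarrow> left_wins_first (G + X)) \<and>
     (right_wins_first (G + X) \<longrightarrow> right_wins_first (H + X)))"
  by (auto simp: game_ge_def outcome_def less_eq_outcome_def split: if_splits)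

lemma game_ge_refl [simp]: "G \<succeq> G"
  by (simp add: game_ge_def)

lemma game_ge_trans [trans]: "G \<succeq> H \<Longrightarrow> H \<succeq> K \<Longrightarrow> G \<succeq> K"
  unfolding game_ge_def by (meson order_trans)

lemma game_ge_plus: "G \<succeq> H \<Longrightarrow> G + X \<succeq> H + X"
  by (simp add: game_ge_def add.assoc)

lemma game_eq_refl [simp]: "G \<simeq> G"
  by (simp add: game_eq_def)

lemma game_eq_sym: "G \<simeq> H \<Longrightarrow> H \<simeq> G"
  by (simp add: game_eq_def)

lemma game_eq_trans [trans]: "G \<simeq> H \<Longrightarrow> H \<simeq> K \<Longrightarrow> G \<simeq> K"
  unfolding game_eq_def using game_ge_trans by blast

lemma game_eq_plus: "G \<simeq> H \<Longrightarrow> G + X \<simeq> H + X"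
  by (simp add: game_eq_def game_ge_plus)

lemma game_eq_plus2: "G \<simeq> H \<Longrightarrow> X + G \<simeq> X + H"
  by (metis game_eq_plus add.commute)

section \<open>Recursive description of the order\<close>

text \<open>Induction on \<open>X\<close>. Left can move only in \<open>X\<close>, with the same
  moves on both sides; Right's winning move to \<open>G' + X\<close> is replaced by
  \<open>H' + X\<close>, which Left loses as well. The premise \<open>zero\<close> covers positions
  that Right wins by having no move.\<close>

lemma game_geI:
  assumes "left_dead_end G" "left_dead_end H"
    and zero: "right_opts G = {||} \<Longrightarrow> right_opts H = {||}"
    and opts: "\<And>G'. G' |\<in>| right_opts G \<Longrightarrow> \<exists>H' |\<in>| right_opts H. G' \<succeq> H'"
  shows "G \<succeq> H"
proof -
  have "(left_wins_first (H + X) \<longrightarrow> left_wins_first (G + X)) \<and>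
     (right_wins_first (G + X) \<longrightarrow> right_wins_first (H + X))" for X
  proof (induction "size X" arbitrary: X rule: less_induct)
    case less
    have "left_wins_first (G + X)" if "left_wins_first (H + X)"
      using that less size_left_option
      unfolding left_wins_first.simps[of "_ + X"] assms(1,2)[THEN left_opts_plus_left_dead_end]
      by auto
    moreover have "right_wins_first (H + X)" if wins: "right_wins_first (G + X)"
    proof (cases "right_opts (G + X) = {||}")
      case True
      then show ?thesis
        using zero by (auto simp: right_opts_plus right_wins_first.simps)
    next
      case False
      then obtain K where "K |\<in>| right_opts (G + X)" and K: "\<not> left_wins_first K"
        using wins by (auto simp: right_wins_first.simps)
      then consider G' where "G' |\<in>| right_opts G" "K = G' + X"
        | X' where "X' |\<in>| right_opts X" "K = G + X'"
        by (auto simp: right_opts_plus_iff)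
      then have "\<exists>L |\<in>| right_opts (H + X). \<not> left_wins_first L"
      proof cases
        case 1
        then obtain H' where "H' |\<in>| right_opts H" "G' \<succeq> H'"
          using opts by blast
        then show ?thesis
          using K 1 by (meson game_ge_iff_wins right_opts_plusI1)
      next
        case 2
        then show ?thesis
          using K less size_right_option by (meson right_opts_plusI2)
      qed
      then show ?thesis
        by (auto simp: right_wins_first.simps)
    qed
    ultimately show ?case by blast
  qed
  then show ?thesis
    by (simp add: game_ge_iff_wins)
qed

text \<open>Enough spare moves for Left make Right win \<open>G + X\<close>: Right runs out of moves first.\<close>

lemma right_wins_first_plus_left_moves:
  assumes "left_dead_end G"
  shows "\<exists>X. right_wins_first (G + X)"
proof -
  \<comment> \<open>\<open>Z n\<close> is a chain of \<open>n\<close> Left moves. Each round uses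
    one of them and one Right move in \<open>G\<close>, so \<open>size G \<le> n\<close> is
    preserved.\<close>
  define Z where "Z n = ((\<lambda>X. Game {|X|} {||}) ^^ n) 0" for n :: nat
  have "right_wins_first (G + Z n)" if "left_dead_end G" "size G \<le> n" for G n
    using that
  proof (induction n arbitrary: G)
    case 0
    then show ?case by (cases G) simp
  next
    case (Suc n)
    have Z: "right_opts (Z (Suc n)) = {||}" "left_opts (Z (Suc n)) = {|Z n|}"
      by (simp_all add: Z_def)
    show ?case
    proof (cases "right_opts G = {||}")
      case True
      then show ?thesis
        using Z by (simp add: right_wins_first.simps right_opts_plus)
    next
      case False
      then obtain G' where G': "G' |\<in>| right_opts G"
        by blast
      have "right_wins_first (G' + Z n)"
        using Suc G' left_dead_end_right_option size_right_option[OF G'] by simp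
      then have "\<not> left_wins_first (G' + Z (Suc n))"
        using Z left_opts_plus_left_dead_end left_dead_end_right_option[OF Suc.prems(1) G']
        by (simp add: left_wins_first.simps)
      then show ?thesis
        using right_opts_plusI1[OF G'] right_wins_first.simps by blast
    qed
  qed
  then show ?thesis
    using assms by blast
qed

text \<open>Converse of \<open>game_geI\<close>: a failure of the comparison of options is turned
  into a concrete \<open>X\<close> that only the side of \<open>G\<close> lets Right win moving
  first.\<close>

lemma separating_game:
  assumes "left_dead_end G" "left_dead_end H"
    and "right_opts G = {||} \<and> right_opts H \<noteq> {||} \<or>
      (\<exists>G' |\<in>| right_opts G. \<forall>H' |\<in>| right_opts H. \<not> G' \<succeq> H')"
  shows "\<exists>X. right_wins_first (G + X) \<and> \<not> right_wins_first (H + X)"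
  using assms
proof (induction "size G" arbitrary: G H rule: less_induct)
  case less
  note G = less.prems(1) and H = less.prems(2)
  from less.prems(3) consider (zero) "right_opts G = {||}" "right_opts H \<noteq> {||}"
    | (opt) G' where "G' |\<in>| right_opts G" "\<And>H'. H' |\<in>| right_opts H \<Longrightarrow> \<not> G' \<succeq> H'"
    by blast
  then show ?case
  proof cases
    case zero
    \<comment> \<open>Right has no move in \<open>G + X\<close> and wins. In \<open>H + X\<close> he
      must move to some \<open>H' + X\<close>; Left replies with \<open>H' + Y\<close>, where
      \<open>Y\<close> forces Right to move again, and all his moves reach ends, which Left wins
      moving first.\<close>
    define Y where "Y = Game {||} {|0|}"
    have Y: "left_dead_end Y"
      unfolding Y_def by (subst left_dead_end_iff) simp
    define X where "X = Game {|Y|} {||}"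
    have "left_wins_first (H' + X)" if "H' |\<in>| right_opts H" for H'
    proof -
      have H': "left_dead_end H'"
        using H that left_dead_end_right_option by blast
      have "right_opts (H' + Y) \<noteq> {||}"
        by (auto simp: right_opts_plus Y_def)
      moreover have "left_wins_first K" if "K |\<in>| right_opts (H' + Y)" for K
        using that left_dead_end_plus[OF H' Y] left_dead_end_right_option
          left_wins_first_left_dead_end by blast
      ultimately have "\<not> right_wins_first (H' + Y)"
        by (auto simp: right_wins_first.simps)
      then show ?thesis
        by (auto simp: left_wins_first.simps left_opts_plus X_def)
    qed
    then have "\<not> right_wins_first (H + X)"
      using zero by (auto simp: right_wins_first.simps right_opts_plus X_def)
    moreover have "right_wins_first (G + X)"
      using zero by (simp add: right_wins_first.simps right_opts_plus X_def)
    ultimately show ?thesis by blast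
  next
    case opt
    have G': "left_dead_end G'"
      using G opt left_dead_end_right_option by blast
    have "\<exists>X. right_wins_first (G' + X) \<and> \<not> right_wins_first (H' + X)"
      if "H' |\<in>| right_opts H" for H'
    proof -
      have H': "left_dead_end H'"
        using H that left_dead_end_right_option by blast
      show ?thesis
        using less.hyps[OF size_right_option[OF opt(1)] G' H'] opt(2)[OF that] game_geI[OF G' H']
        by blast
    qed
    then obtain X where X: "\<And>H'. H' |\<in>| right_opts H \<Longrightarrow>
        right_wins_first (G' + X H') \<and> \<not> right_wins_first (H' + X H')"
      by metis
    obtain Z where Z: "right_wins_first (G' + Z)"
      using right_wins_first_plus_left_moves[OF G'] by blast
    \<comment> \<open>Right wins \<open>G + T\<close> by moving to \<open>G' + T\<close>, while
      \<open>X H'\<close> is Left's winning answer to \<open>H' + T\<close>. If \<open>H\<close> has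
      no options, \<open>Z\<close> still gives Left a move in \<open>G' + T\<close> and
      \<open>0\<close> still gives Right one in \<open>H + T\<close>, so neither wins there for lack
      of a move.\<close>
    define T where "T = Game (finsert Z (X |`| right_opts H)) {|0|}"
    have "\<not> left_wins_first (G' + T)"
      using X Z by (auto simp: left_wins_first.simps left_opts_plus_left_dead_end[OF G'] T_def)
    then have "right_wins_first (G + T)"
      using right_opts_plusI1[OF opt(1)] right_wins_first.simps by blast
    moreover have "left_wins_first (H' + T)" if "H' |\<in>| right_opts H" for H'
      using X that by (auto simp: left_wins_first.simps left_opts_plus T_def)
    then have "\<not> right_wins_first (H + T)"
      using left_wins_first_left_dead_end[OF H]
      by (auto simp: right_wins_first.simps right_opts_plus T_def)
    ultimately show ?thesis by blast
  qed
qed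

lemma game_ge_iff:
  assumes "left_dead_end G" "left_dead_end H"
  shows "G \<succeq> H \<longleftrightarrow> (right_opts G = {||} \<longrightarrow> right_opts H = {||}) \<and>
    (\<forall>G' |\<in>| right_opts G. \<exists>H' |\<in>| right_opts H. G' \<succeq> H')"
  using separating_game[OF assms] game_geI[OF assms] game_ge_iff_wins by metis

text \<open>Already \<open>0 \<succeq> G\<close> leaves \<open>G\<close> without options. Hence
  tests for the identity of the monoid become tests on forms.\<close>

lemma game_eq_zero_iff: "left_dead_end G \<Longrightarrow> G \<simeq> 0 \<longleftrightarrow> G = 0"
  by (metis game_eq_def game_eq_refl game_ge_iff left_dead_end_zero right_opts_eq_empty_iff
      right_opts_zero)

lemma plus_eq_zero_iff: "G + H = 0 \<longleftrightarrow> G = 0 \<and> H = 0" for G H :: game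
proof
  assume "G + H = 0"
  then have "left_opts (G + H) = {||}" "right_opts (G + H) = {||}"
    by simp_all
  then show "G = 0 \<and> H = 0"
    by (simp add: left_opts_plus right_opts_plus game.expand)
qed simp


section \<open>Lengths of plays\<close>

text \<open>A relation and not a function, since plays of one end may differ in length. Only Right
  moves count.\<close>

inductive play_length :: "nat \<Rightarrow> game \<Rightarrow> bool" where
  play_length_0: "right_opts G = {||} \<Longrightarrow> play_length 0 G"
| play_length_Suc: "G' |\<in>| right_opts G \<Longrightarrow> play_length n G' \<Longrightarrow> play_length (Suc n) G"

lemma play_length_0_iff: "play_length 0 G \<longleftrightarrow> right_opts G = {||}"
  by (auto elim: play_length.cases intro: play_length_0)

lemma play_length_less_size: "play_length n G \<Longrightarrow> n < size G"
proof (induction rule: play_length.induct)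
  case (play_length_0 G)
  then show ?case by (cases G) simp
next
  case (play_length_Suc G' G n)
  then show ?case using size_right_option[of G' G] by simp
qed

lemma ex_play_length: "\<exists>n. play_length n G"
proof (induction "size G" arbitrary: G rule: less_induct)
  case less
  then show ?case
    by (metis size_right_option play_length.intros ex_fin_conv)
qed

text \<open>Each Right move in \<open>G\<close> is matched by one in \<open>H\<close> that keeps the
  comparison, and once \<open>G\<close> is exhausted so is \<open>H\<close>.\<close>

lemma play_length_game_ge:
  "play_length n G \<Longrightarrow> G \<succeq> H \<Longrightarrow> left_dead_end G \<Longrightarrow> left_dead_end H \<Longrightarrow> play_length n H"
proof (induction arbitrary: H rule: play_length.induct)
  case (play_length_0 G)
  then show ?case using game_ge_iff play_length.play_length_0 by blast
next
  case (play_length_Suc G' G n)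
  then show ?case
    by (meson game_ge_iff left_dead_end_right_option play_length.play_length_Suc)
qed

lemma play_length_game_eq:
  "play_length n G \<Longrightarrow> G \<simeq> H \<Longrightarrow> left_dead_end G \<Longrightarrow> left_dead_end H \<Longrightarrow> play_length n H"
  using play_length_game_ge game_eq_def by blast

text \<open>Play out \<open>G\<close> first, then \<open>H\<close>. Together with
  \<open>play_length_plusE\<close> this makes the lengths for \<open>G + H\<close> the sumset of
  those for \<open>G\<close> and \<open>H\<close>.\<close>

lemma play_length_plus:
  assumes "play_length m G" "play_length n H"
  shows "play_length (m + n) (G + H)"
  using assms
proof (induction arbitrary: n H rule: play_length.induct)
  case (play_length_0 G)
  from this(2,1) show ?case
    by (induction rule: play_length.induct)
      (auto simp: right_opts_plus intro: play_length.intros right_opts_plusI2)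
next
  case (play_length_Suc G' G m)
  then show ?case
    using right_opts_plusI1 play_length.play_length_Suc by fastforce
qed

lemma play_length_plusE:
  "play_length k (G + H) \<Longrightarrow> \<exists>m n. play_length m G \<and> play_length n H \<and> k = m + n"
proof (induction k "G + H" arbitrary: G H rule: play_length.induct)
  case play_length_0
  then show ?case
    by (simp add: right_opts_plus play_length_0_iff)
next
  case (play_length_Suc K n)
  then show ?case
    unfolding right_opts_plus_iff
    by (metis add_Suc add_Suc_right play_length.play_length_Suc)
qed

section \<open>Comparison with multiples, and cancellation\<close>

text \<open>The shortest play length of \<open>X\<close> is also one of \<open>H + X\<close>. The
  share of \<open>X\<close> in it cannot be shorter, so the share of \<open>H\<close> is
  empty.\<close>

lemma game_ge_plus_self:
  assumes "X \<succeq> H + X" "left_dead_end X" "left_dead_end H"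
  shows "H = 0"
proof -
  define n where "n = (LEAST n. play_length n X)"
  have n: "play_length n X" "\<And>m. play_length m X \<Longrightarrow> n \<le> m"
    unfolding n_def using ex_play_length LeastI_ex Least_le by metis+
  then have "play_length n (H + X)"
    using assms play_length_game_ge left_dead_end_plus by blast
  then obtain a b where "play_length a H" "play_length b X" "n = a + b"
    using play_length_plusE by blast
  then have "play_length 0 H"
    using n(2)[of b] by simp
  then show ?thesis
    using assms(3) play_length_0_iff right_opts_eq_empty_iff by blast
qed

text \<open>The longest play length of \<open>B\<close> is reached or exceeded by
  \<open>X + B\<close>, hence by \<open>B'\<close>; the move from \<open>B\<close> to
  \<open>B'\<close> would make it longer still.\<close>

lemma option_not_eq_multiple:
  assumes "B' |\<in>| right_opts B" "X + B \<simeq> B'" "left_dead_end X" "left_dead_end B"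
  shows False
proof -
  define n where "n = (GREATEST n. play_length n B)"
  have bound: "\<forall>m. play_length m B \<longrightarrow> m \<le> size B"
    using play_length_less_size less_imp_le by blast
  then have n: "play_length n B" "\<And>m. play_length m B \<Longrightarrow> m \<le> n"
    unfolding n_def
    using GreatestI_ex_nat[OF ex_play_length[of B]] Greatest_le_nat[of "\<lambda>n. play_length n B"]
    by (metis (no_types, lifting))+
  obtain x where "play_length x X"
    using ex_play_length by blast
  then have "play_length (x + n) B'"
    using n(1) assms play_length_plus play_length_game_eq left_dead_end_plus
      left_dead_end_right_option by metis
  then show False
    using assms(1) n(2) play_length_Suc by fastforce
qed

lemma game_ge_cancel:
  assumes "G + X \<succeq> H + X" "left_dead_end G" "left_dead_end H" "left_dead_end X"
  shows "G \<succeq> H"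
  using assms
proof (induction "size G" arbitrary: G H X rule: less_induct)
  case less
  note G = less.prems(2) and H = less.prems(3) and X = less.prems(4)
  have "\<exists>H' |\<in>| right_opts H. G' \<succeq> H'" if G': "G' |\<in>| right_opts G" for G'
  proof -
    have dG': "left_dead_end G'"
      using G G' left_dead_end_right_option by blast
    \<comment> \<open>An answer \<open>H' + Y\<close> lets the induction hypothesis for
      \<open>G'\<close> cancel \<open>Y\<close>. Otherwise the answer was a move in
      \<open>Y\<close>.\<close>
    have reply: "(\<exists>H' |\<in>| right_opts H. G' \<succeq> H') \<or> (\<exists>Y' |\<in>| right_opts Y. K \<succeq> H + Y')"
      if "K \<succeq> L" "L |\<in>| right_opts (H + Y)" "K = G' + Y" "left_dead_end Y" for K L Y
    proof -
      from that(2) consider H' where "H' |\<in>| right_opts H" "L = H' + Y"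
        | Y' where "Y' |\<in>| right_opts Y" "L = H + Y'"
        by (auto simp: right_opts_plus_iff)
      then show ?thesis
        using less.hyps[OF size_right_option[OF G'] _ dG'] that(1,3,4) H
          left_dead_end_right_option by (cases; metis)
    qed
    text \<open>Answering each move \<open>Y'\<close> in \<open>Y\<close> on the right by the same move on the left
      eventually exhausts \<open>Y\<close>.\<close>
    have copy: "\<exists>H' |\<in>| right_opts H. G' \<succeq> H'"
      if "G' + Y \<succeq> H + Y'" "Y' |\<in>| right_opts Y" "left_dead_end Y" for Y Y'
      using that
    proof (induction "size Y" arbitrary: Y Y' rule: less_induct)
      case (less Y Y')
      have Y': "left_dead_end Y'"
        using less.prems left_dead_end_right_option by blast
      have "G' + Y' |\<in>| right_opts (G' + Y)"
        using less.prems right_opts_plusI2 by blast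
      then obtain L where L: "L |\<in>| right_opts (H + Y')" "G' + Y' \<succeq> L"
        using less.prems game_ge_iff left_dead_end_plus dG' H Y' by metis
      show ?case
        using reply[OF L(2,1) refl Y'] less.hyps[OF size_right_option[OF less.prems(2)]] Y' by blast
    qed
    have "G' + X |\<in>| right_opts (G + X)"
      using G' right_opts_plusI1 by blast
    then obtain L where L: "L |\<in>| right_opts (H + X)" "G' + X \<succeq> L"
      using less.prems game_ge_iff left_dead_end_plus by metis
    show ?thesis
      using reply[OF L(2,1) refl X] copy X by blast
  qed
  \<comment> \<open>Here \<open>G = 0\<close>, so the assumption reads
    \<open>X \<succeq> H + X\<close>.\<close>
  moreover have "right_opts H = {||}" if "right_opts G = {||}"
    using that less.prems right_opts_eq_empty_iff game_ge_plus_self by fastforce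
  ultimately show ?case
    using game_geI G H by blast
qed

lemma game_eq_cancel:
  "G + X \<simeq> H + X \<Longrightarrow> left_dead_end G \<Longrightarrow> left_dead_end H \<Longrightarrow> left_dead_end X \<Longrightarrow> G \<simeq> H"
  unfolding game_eq_def using game_ge_cancel by blast


section \<open>Factorisations\<close>

lemma atom_left_dead_end: "atom A \<Longrightarrow> left_dead_end A"
  and atom_not_zero: "atom A \<Longrightarrow> A \<noteq> 0"
  by (auto simp: atom_def)

lemma atom_eq_plusD:
  "atom A \<Longrightarrow> A \<simeq> X + Y \<Longrightarrow> left_dead_end X \<Longrightarrow> left_dead_end Y \<Longrightarrow> X = 0 \<or> Y = 0"
  by (simp add: atom_def game_eq_zero_iff)

lemma divides_atom:
  assumes "divides P A" "atom A" "left_dead_end P" "P \<noteq> 0"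
  shows "A \<simeq> P"
  using assms atom_eq_plusD unfolding divides_def by (metis add.right_neutral)

lemma primeE:
  assumes "prime_end P"
  shows "left_dead_end P" "P \<noteq> 0"
    "\<And>X Y. divides P (X + Y) \<Longrightarrow> left_dead_end X \<Longrightarrow> left_dead_end Y \<Longrightarrow> divides P X \<or> divides P Y"
  using assms by (auto simp: prime_end_def)

lemma game_eq_cancel_common:
  assumes "U \<simeq> V" "U \<simeq> G + X" "V \<simeq> H + X" "left_dead_end G" "left_dead_end H" "left_dead_end X"
  shows "G \<simeq> H"
  by (meson assms game_eq_cancel game_eq_sym game_eq_trans)

section \<open>Matching one atom of two factorisations\<close>

text \<open>\<open>D\<close> is what remains of an option of \<open>B\<close>; not being a multiple
  of \<open>B\<close> passes on to its divisors. \<open>N\<close> bounds the number of remaining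
  primes plus the longest play of \<open>S\<close>, and each cancellation lowers this, whether a
  prime leaves \<open>Ps\<close> or \<open>S\<close>.\<close>

lemma prime_factors_cancel:
  assumes "atom A" "atom B" "\<forall>P \<in> set Ps. prime_end P"
    and "left_dead_end D" "left_dead_end S" "left_dead_end T"
    and "sum_list Ps + S \<simeq> D + T" "A + S \<simeq> B + T"
    and "\<And>X. left_dead_end X \<Longrightarrow> \<not> X + B \<simeq> D"
    and "\<And>m. play_length m S \<Longrightarrow> length Ps + m \<le> N"
  shows "A \<simeq> B"
  using assms
proof (induction N arbitrary: Ps D S T rule: less_induct)
  case (less N)
  note A = atom_left_dead_end[OF \<open>atom A\<close>] and B = atom_left_dead_end[OF \<open>atom B\<close>]
  note D = less.prems(4) and S = less.prems(5) and T = less.prems(6)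
  note eqD = less.prems(7) and eqB = less.prems(8)
  note no_multiple = less.prems(9) and bound = less.prems(10)
  show ?case
  proof (cases Ps)
    case Nil
    then have "S \<simeq> D + T"
      using eqD by simp
    \<comment> \<open>Substituting for \<open>S\<close> and cancelling \<open>T\<close> gives
      \<open>A + D \<simeq> B\<close>; as \<open>B\<close> is an atom and \<open>A\<close> is not
      zero, \<open>D\<close> must vanish.\<close>
    then have "A + S \<simeq> (A + D) + T"
      using game_eq_plus2 by (simp add: add.assoc)
    then have AD: "A + D \<simeq> B"
      using game_eq_cancel_common[OF eqB _ game_eq_refl] left_dead_end_plus A B D T by blast
    then have "D = 0"
      using atom_eq_plusD[OF \<open>atom B\<close> game_eq_sym A D] atom_not_zero[OF \<open>atom A\<close>] by blast
    then show ?thesis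
      using AD by simp
  next
    case (Cons P Qs)
    define Q where "Q = sum_list Qs"
    have "prime_end P"
      using Cons less.prems(3) by simp
    note P = primeE[OF this]
    have Q: "left_dead_end Q"
      unfolding Q_def using Cons less.prems(3) primeE(1) by (auto intro!: left_dead_end_sum_list)
    have PQ: "sum_list Ps = P + Q"
      by (simp add: Cons Q_def)
    \<comment> \<open>Needed to recurse at \<open>N - 1\<close>: \<open>Ps\<close> is nonempty and
      \<open>S\<close> has some play.\<close>
    have "N > 0"
      using ex_play_length[of S] bound Cons by fastforce
    have "divides P (D + T)"
      unfolding divides_def
      using game_eq_sym[OF eqD] left_dead_end_plus[OF Q S] by (auto simp: PQ add.assoc)
    then consider "divides P D" | "divides P T"
      using P(3) D T by blast
    then show ?thesis
    proof cases
      case 1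
      then obtain D2 where D2: "left_dead_end D2" "D \<simeq> P + D2"
        by (auto simp: divides_def)
      have "D + T \<simeq> (D2 + T) + P"
        using game_eq_plus[OF D2(2), of T] by (simp add: ac_simps)
      moreover have "sum_list Ps + S \<simeq> (Q + S) + P"
        by (simp add: PQ ac_simps)
      ultimately have "Q + S \<simeq> D2 + T"
        using game_eq_cancel_common[OF eqD] left_dead_end_plus D2 P Q S T by blast
      moreover have "\<not> X + B \<simeq> D2" if "left_dead_end X" for X
      proof
        assume "X + B \<simeq> D2"
        then have "P + X + B \<simeq> D"
          using game_eq_plus2[of "X + B" D2 P] D2(2) game_eq_sym game_eq_trans
          by (metis add.assoc)
        then show False
          using no_multiple left_dead_end_plus P(1) that by blast
      qed
      moreover have "length Qs + m \<le> N - 1" if "play_length m S" for m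
        using bound[OF that] Cons by simp
      ultimately show ?thesis
        using less.IH[of "N - 1" Qs D2 S T] \<open>N > 0\<close> less.prems(1-3) Cons D2 S T eqB
        by (simp add: Q_def)
    next
      case 2
      then obtain T2 where T2: "left_dead_end T2" "T \<simeq> P + T2"
        by (auto simp: divides_def)
      have BT: "B + T \<simeq> (B + T2) + P" and DT: "D + T \<simeq> (D + T2) + P"
        using game_eq_plus2[OF T2(2), of B] game_eq_plus2[OF T2(2), of D] by (simp_all add: ac_simps)
      have "A + S \<simeq> P + (B + T2)"
        using game_eq_trans[OF eqB BT] by (simp add: ac_simps)
      then have "divides P (A + S)"
        using left_dead_end_plus B T2 by (auto simp: divides_def)
      then consider "divides P A" | "divides P S"
        using P(3) A S by blast
      then show ?thesis
      proof cases
        case 1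
        \<comment> \<open>This branch is contradictory: cancelling \<open>A\<close> leaves
          \<open>S \<simeq> B + T2\<close>, which makes \<open>D\<close> the multiple
          \<open>Q + B\<close> of \<open>B\<close>.\<close>
        then have "A \<simeq> P"
          using divides_atom P less.prems(1) by blast
        then have "A + S \<simeq> S + P"
          using game_eq_plus by (metis add.commute)
        then have "S \<simeq> B + T2"
          using game_eq_cancel_common[OF eqB _ BT] left_dead_end_plus B P S T2 by blast
        then have "sum_list Ps + S \<simeq> (Q + B) + (T2 + P)"
          using game_eq_plus2[of S "B + T2" "P + Q"] by (simp add: PQ ac_simps)
        then have "Q + B \<simeq> D"
          using game_eq_cancel_common[OF eqD, of "Q + B" "T2 + P" D] DT
            left_dead_end_plus B D P Q T2 by (simp add: add.assoc)
        then show ?thesis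
          using no_multiple Q by blast
      next
        case 2
        then obtain S2 where S2: "left_dead_end S2" "S \<simeq> P + S2"
          by (auto simp: divides_def)
        have "A + S \<simeq> (A + S2) + P" and "sum_list Ps + S \<simeq> (sum_list Ps + S2) + P"
          using game_eq_plus2[OF S2(2), of A] game_eq_plus2[OF S2(2), of "sum_list Ps"]
          by (simp_all add: ac_simps)
        then have "A + S2 \<simeq> B + T2" "sum_list Ps + S2 \<simeq> D + T2"
          using game_eq_cancel_common[OF eqB _ BT] game_eq_cancel_common[OF eqD _ DT]
            left_dead_end_plus A B D P Q S2 T2 by (simp_all add: PQ)
        moreover have "length Ps + m \<le> N - 1" if "play_length m S2" for m
        proof -
          obtain p where p: "play_length p P"
            using ex_play_length by blast
          then have "p \<noteq> 0"
            using P(1,2) play_length_0_iff right_opts_eq_empty_iff by metis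
          moreover have "play_length (p + m) S"
            using play_length_game_eq[OF play_length_plus[OF p that] game_eq_sym[OF S2(2)]]
              left_dead_end_plus P(1) S S2(1) by blast
          ultimately show ?thesis
            using bound[of "p + m"] by simp
        qed
        ultimately show ?thesis
          using less.IH[of "N - 1" Ps D S2 T2] \<open>N > 0\<close> less.prems(1-4,9) S2 T2 by simp
      qed
    qed
  qed
qed

text \<open>Answer \<open>K\<close> by \<open>L\<close> in \<open>H\<close> and \<open>L\<close> by
  \<open>M\<close> in \<open>G\<close>, so that \<open>K \<succeq> L \<succeq> M\<close>. A good
  option is minimal, so the chain collapses to equalities.\<close>

lemma good_option_game_eq:
  assumes "good_option K G" "G \<simeq> H" "left_dead_end G" "left_dead_end H"
  shows "\<exists>L |\<in>| right_opts H. K \<simeq> L"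
proof -
  have K: "K |\<in>| right_opts G" "\<And>G''. G'' |\<in>| right_opts G \<Longrightarrow> K \<succeq> G'' \<Longrightarrow> K \<simeq> G''"
    using assms(1) by (auto simp: good_option_def game_gt_def)
  obtain L where L: "L |\<in>| right_opts H" "K \<succeq> L"
    using K(1) assms(2-4) game_eq_def game_ge_iff by metis
  obtain M where M: "M |\<in>| right_opts G" "L \<succeq> M"
    using L(1) assms(2-4) game_eq_def game_ge_iff by metis
  have "M \<succeq> K"
    using K(2)[OF M(1)] L(2) M(2) game_ge_trans game_eq_def by blast
  then show ?thesis
    using L M(2) game_ge_trans game_eq_def by blast
qed

lemma right_opts_sum_listE:
  assumes "K |\<in>| right_opts (sum_list Bs)"
  obtains Us B Vs B' where "Bs = Us @ B # Vs" "B' |\<in>| right_opts B" "K = B' + sum_list (Us @ Vs)"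
  using assms
proof (induction Bs arbitrary: K thesis)
  case Nil
  then show ?case by simp
next
  case (Cons C Bs)
  from Cons.prems(2) consider C' where "C' |\<in>| right_opts C" "K = C' + sum_list Bs"
    | L where "L |\<in>| right_opts (sum_list Bs)" "K = C + L"
    by (auto simp: right_opts_plus_iff)
  then show ?case
  proof cases
    case 1
    then show ?thesis
      using Cons.prems(1)[of "[]" C Bs C'] by simp
  next
    case 2
    from Cons.IH[OF _ 2(1)] obtain Us B Vs B' where
      "Bs = Us @ B # Vs" "B' |\<in>| right_opts B" "L = B' + sum_list (Us @ Vs)"
      by blast
    then show ?thesis
      using Cons.prems(1)[of "C # Us" B Vs B'] 2(2) by (simp add: ac_simps)
  qed
qed

text \<open>Induction on \<open>As\<close>: index 0 of the last hypothesis pairs the head with some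
  atom of \<open>Bs\<close>, and the later indices are the same hypothesis for the tail.\<close>

lemma atoms_unique:
  assumes "\<forall>A \<in> set As. atom A" "\<forall>B \<in> set Bs. atom B" "sum_list As \<simeq> sum_list Bs"
    and "\<And>i. i < length As \<Longrightarrow>
      \<exists>A'. A' |\<in>| right_opts (As ! i) \<and> prime_factorisable A' \<and>
        good_option (A' + sum_list (drop (Suc i) As)) (sum_list (drop i As))"
  shows "rel_mset (\<simeq>) (mset As) (mset Bs)"
  using assms
proof (induction As arbitrary: Bs)
  case Nil
  have "sum_list Bs = 0"
    using Nil.prems(2,3) left_dead_end_sum_list atom_left_dead_end game_eq_sym game_eq_zero_iff
    by (metis sum_list.Nil)
  then have "Bs = []"
    using Nil.prems(2) atom_not_zero by (cases Bs) (auto simp: plus_eq_zero_iff)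
  then show ?case
    by (simp add: rel_mset_Zero)
next
  case (Cons A As)
  define S where "S = sum_list As"
  have atoms: "atom A" "\<forall>A \<in> set As. atom A"
    using Cons.prems(1) by auto
  have A: "left_dead_end A" and S: "left_dead_end S"
    unfolding S_def using atoms atom_left_dead_end left_dead_end_sum_list by blast+
  have sum_Bs: "left_dead_end (sum_list Bs)"
    using Cons.prems(2) atom_left_dead_end left_dead_end_sum_list by blast
  have eq: "A + S \<simeq> sum_list Bs"
    using Cons.prems(3) by (simp add: S_def)
  from Cons.prems(4)[of 0] obtain A' where A': "A' |\<in>| right_opts A" "prime_factorisable A'"
    "good_option (A' + S) (A + S)"
    by (auto simp: S_def)
  obtain K where "K |\<in>| right_opts (sum_list Bs)" and K: "A' + S \<simeq> K"
    using good_option_game_eq[OF A'(3) eq] left_dead_end_plus A S sum_Bs by blast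
  then obtain Us B Vs B' where Bs: "Bs = Us @ B # Vs" and B': "B' |\<in>| right_opts B"
    and K_eq: "K = B' + sum_list (Us @ Vs)"
    using right_opts_sum_listE by blast
  define T where "T = sum_list (Us @ Vs)"
  have atomsB: "atom B" "\<forall>B \<in> set (Us @ Vs). atom B"
    using Cons.prems(2) Bs by auto
  have B: "left_dead_end B" and T: "left_dead_end T"
    unfolding T_def using atomsB atom_left_dead_end left_dead_end_sum_list by blast+
  have AS_BT: "A + S \<simeq> B + T"
    using eq by (simp add: Bs T_def ac_simps)
  obtain Ps where Ps: "\<forall>P \<in> set Ps. prime_end P" "A' \<simeq> sum_list Ps"
    using A'(2) by (auto simp: prime_factorisable_def factorisation_def)
  have "sum_list Ps + S \<simeq> B' + T"
    using game_eq_trans[OF game_eq_sym[OF game_eq_plus[OF Ps(2)]] K] by (simp add: K_eq T_def)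
  \<comment> \<open>Play lengths are below the size, so this bound starts the induction of
    \<open>prime_factors_cancel\<close> with \<open>D = B'\<close>.\<close>
  moreover have "length Ps + m \<le> length Ps + size S" if "play_length m S" for m
    using play_length_less_size[OF that] by simp
  ultimately have "A \<simeq> B"
    using prime_factors_cancel[OF atoms(1) atomsB(1) Ps(1) left_dead_end_right_option[OF B B'] S T
        _ AS_BT] option_not_eq_multiple[OF B' _ _ B] by blast
  \<comment> \<open>With \<open>A\<close> in place of \<open>B\<close> the two sums share a summand,
    and cancelling it equates the tails.\<close>
  have "A + T \<simeq> B + T"
    using game_eq_plus \<open>A \<simeq> B\<close> by blast
  then have "S + A \<simeq> T + A"
    using AS_BT game_eq_sym game_eq_trans by (metis add.commute)
  then have "S \<simeq> T"
    using game_eq_cancel A S T by blast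
  have "rel_mset (\<simeq>) (mset As) (mset (Us @ Vs))"
  proof (rule Cons.IH[OF atoms(2) atomsB(2)])
    show "sum_list As \<simeq> sum_list (Us @ Vs)"
      using \<open>S \<simeq> T\<close> by (simp add: S_def T_def)
    show "\<exists>A'. A' |\<in>| right_opts (As ! i) \<and> prime_factorisable A' \<and>
        good_option (A' + sum_list (drop (Suc i) As)) (sum_list (drop i As))"
      if "i < length As" for i
      using Cons.prems(4)[of "Suc i"] that by simp
  qed
  then have "rel_mset (\<simeq>) (add_mset A (mset As)) (add_mset B (mset (Us @ Vs)))"
    using \<open>A \<simeq> B\<close> by (rule rel_mset_Plus[rotated])
  then show ?case
    by (simp add: Bs)
qed

theorem mainTheorem17:
  fixes G :: game and Gs :: "game list"
  assumes "left_dead_end G"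
    and "factorisation Gs G"
    and "\<And>i. i < length Gs \<Longrightarrow>
      \<exists>G'. G' |\<in>| right_opts (Gs ! i) \<and> prime_factorisable G' \<and>
        good_option (G' + sum_list (drop (Suc i) Gs)) (sum_list (drop i Gs))"
  shows "uniquely_factorisable G"
proof -
  have "rel_mset (\<simeq>) (mset Gs) (mset Bs)" if "factorisation Bs G" for Bs
    using that assms(2) game_eq_sym game_eq_trans
    unfolding factorisation_def by (intro atoms_unique assms(3)) blast+
  then show ?thesis
    using assms(2) uniquely_factorisable_def by blast
qed

end
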